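(* Consider an IRPS-LP with dual lower bound $D(\phi)$. Then each iteration of the following message-passing algorithm, for any choice of its free parameters (factor order, sets $J_{receive}$, partitions $J_1,\dots,J_l$, vectors $\delta$, weights $\omega$), never decreases the dual lower bound; that is, $D$ is non-decreasing along all updates of $\phi$ made by the algorithm. Procedure (update step) with input a factor $i$, a set $J\subseteq\mathcal{N}_{\mathbb{G}}(i)$, and current dual variables $\phi$: compute $x_i^*\in\arg\min_{x_i\in X_i}\langle\theta^\phi_i,x_i\rangle$; choose $\delta\in\mathbb{R}^{d_i}$ with $\delta(s)>0$ if $x_i^*(s)=1$ and $\delta(s)<0$ if $x_i^*(s)=0$; output $\Delta^*_{(i,J)}\in\arg\max_{\Delta\in AD(\theta^\phi_i,x_i^*,J)}\langle\delta,\theta_i^{\phi+\Delta}\rangle$. Algorithm (one iteration): for each $i\in\mathbb{F}$ in some order: (Receive) choose $J_{receive}\subseteq\mathcal{N}_{\mathbb{G}}(i)$; for each $j\in J_{receive}$, compute $\Delta^*_{(j,\{i\})}$ by the procedure applied to factor $j$ with set $\{i\}$ and the current $\phi$, and set $\phi\leftarrow\phi+\Delta^*_{(j,\{i\})}$. (Send) choose pairwise disjoint sets $J_1,\dots,J_l$ with $J_1\cup\dots\cup J_l\subseteq\mathcal{N}_{\mathbb{G}}(i)$; for each $t$, compute $\Delta^*_{(i,J_t)}$ by the procedure applied to factor $i$ with set $J_t$ and the current $\phi$ (the same $\phi$ for all $t$); choose weights $\omega_{J_1},\dots,\omega_{J_l}\ge0$ with $\sum_t\omega_{J_t}\le 1$;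 then set $\phi\leftarrow\phi+\sum_{t}\omega_{J_t}\Delta^*_{(i,J_t)}$.
   Context: IRPS-LP setting: $\mathbb{F}=\{1,\dots,k\}$ finite set of factors, $\mathbb{E}\subseteq\binom{\mathbb{F}}{2}$, factor graph $\mathbb{G}=(\mathbb{F},\mathbb{E})$, $\mathcal{N}_{\mathbb{G}}(i)=\{j:ij\in\mathbb{E}\}$; $X_i\subseteq\{0,1\}^{d_i}$, $\theta_i\in\mathbb{R}^{d_i}$; for $ij\in\mathbb{E}$ matrices $A_{(i,j)}\in\{0,1\}^{K\times d_i}$, $A_{(j,i)}\in\{0,1\}^{K\times d_j}$ with $A_{(i,j)}x_i\in\{0,1\}^K$ for all $x_i\in X_i$ and $A_{(j,i)}x_j\in\{0,1\}^K$ for all $x_j\in X_j$. Dual variables $\phi_{(i,j)}\in\mathbb{R}^K$ with $\phi_{(i,j)}=-\phi_{(j,i)}$; $\theta^\phi_i:=\theta_i+\sum_{j:\,ij\in\mathbb{E}}A_{(i,j)}^\top\phi_{(i,j)}$; dual lower bound $D(\phi):=\sum_{i\in\mathbb{F}}\min_{x_i\in X_i}\langle\theta^\phi_i,x_i\rangle$. $AD(\theta^\phi_i,x_i^*,J)$ is the set of dual increments $\Delta$ whose only nonzero components are $\Delta_{(i,j)}$ and $\Delta_{(j,i)}=-\Delta_{(i,j)}$ for $j\in J$, such that for each $j\in J$, with $\nu:=A_{(i,j)}x_i^*$, $\Delta_{(i,j)}(s)\ge0$ when $\nu(s)=1$ and $\Delta_{(i,j)}(s)\le 0$ when $\nu(s)=0$,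 and such that $x_i^*\in\arg\min_{x_i\in X_i}\langle\theta_i^{\phi+\Delta},x_i\rangle$. *)

theory Defs
  imports "HOL-Library.Disjoint_Sets" "Jordan_Normal_Form.Matrix"
begin

text \<open>
  Data of an IRPS-LP. Factors are the numbers \<open>1, \<dots>, num_factors\<close> and an edge \<open>ij\<close> is the
  two-element set \<open>{i, j}\<close>. The number of rows shared by \<open>A\<^bsub>(i,j)\<^esub>\<close> and \<open>A\<^bsub>(j,i)\<^esub>\<close>
  may depend on the edge; \<open>coupling P (i, j)\<close> is \<open>A\<^bsub>(i,j)\<^esub>\<close>.
\<close>

record irps_lp =
  num_factors :: nat
  edges :: "nat set set"
  label_dim :: "nat \<Rightarrow> nat"
  labelings :: "nat \<Rightarrow> real vec set"
  costs :: "nat \<Rightarrow> real vec"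
  coupling_dim :: "nat set \<Rightarrow> nat"
  coupling :: "nat \<times> nat \<Rightarrow> real mat"

definition factors :: "irps_lp \<Rightarrow> nat set" where
  "factors P = {1..num_factors P}"

definition nbrs :: "irps_lp \<Rightarrow> nat \<Rightarrow> nat set" where
  "nbrs P i = {j. {i, j} \<in> edges P}"

definition binary_vecs :: "nat \<Rightarrow> real vec set" where
  "binary_vecs n = {x \<in> carrier_vec n. \<forall>s<n. x $ s \<in> {0, 1}}"

definition valid_irps_lp :: "irps_lp \<Rightarrow> bool" where
  "valid_irps_lp P \<longleftrightarrow>
     edges P \<subseteq> {e. e \<subseteq> factors P \<and> card e = 2} \<and>
     (\<forall>i\<in>factors P. labelings P i \<subseteq> binary_vecs (label_dim P i) \<and>
                    costs P i \<in> carrier_vec (label_dim P i)) \<and>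
     (\<forall>i j. {i, j} \<in> edges P \<longrightarrow>
        coupling P (i, j) \<in> carrier_mat (coupling_dim P {i, j}) (label_dim P i) \<and>
        elements_mat (coupling P (i, j)) \<subseteq> {0, 1} \<and>
        (\<forall>x\<in>labelings P i. coupling P (i, j) *\<^sub>v x \<in> binary_vecs (coupling_dim P {i, j})))"

text \<open>
  Dual variables are functions on all pairs of numbers, but only their values at pairs
  \<open>(i, j)\<close> with \<open>{i, j}\<close> an edge are constrained or ever used.
\<close>

type_synonym dual = "nat \<times> nat \<Rightarrow> real vec"

definition dual_vars :: "irps_lp \<Rightarrow> dual set" where
  "dual_vars P = {\<phi>. \<forall>i j. {i, j} \<in> edges P \<longrightarrow>
     \<phi> (i, j) \<in> carrier_vec (coupling_dim P {i, j}) \<and> \<phi> (i, j) = - \<phi> (j, i)}"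

definition add_dual :: "dual \<Rightarrow> dual \<Rightarrow> dual" where
  "add_dual \<phi> \<Delta> = (\<lambda>e. \<phi> e + \<Delta> e)"

definition reparam :: "irps_lp \<Rightarrow> dual \<Rightarrow> nat \<Rightarrow> real vec" where
  "reparam P \<phi> i = costs P i +
     finsum_vec TYPE(real) (label_dim P i)
       (\<lambda>j. transpose_mat (coupling P (i, j)) *\<^sub>v \<phi> (i, j)) (nbrs P i)"

text \<open>
  The minimum below is over a finite set. It is unspecified if \<open>labelings P i\<close> is empty, but it
  is then the same number for every \<open>\<phi>\<close>.
\<close>

definition dual_bound :: "irps_lp \<Rightarrow> dual \<Rightarrow> real" where
  "dual_bound P \<phi> = (\<Sum>i\<in>factors P. Min ((\<lambda>x. reparam P \<phi> i \<bullet> x) ` labelings P i))"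

definition opt_labeling :: "irps_lp \<Rightarrow> dual \<Rightarrow> nat \<Rightarrow> real vec \<Rightarrow> bool" where
  "opt_labeling P \<phi> i = is_arg_min (\<lambda>x. reparam P \<phi> i \<bullet> x) (\<lambda>x. x \<in> labelings P i)"

definition AD :: "irps_lp \<Rightarrow> dual \<Rightarrow> nat \<Rightarrow> real vec \<Rightarrow> nat set \<Rightarrow> dual set" where
  "AD P \<phi> i x J = {\<Delta> \<in> dual_vars P.
     (\<forall>a b. {a, b} \<in> edges P \<and> \<not> (a = i \<and> b \<in> J) \<and> \<not> (b = i \<and> a \<in> J) \<longrightarrow>
        \<Delta> (a, b) = 0\<^sub>v (coupling_dim P {a, b})) \<and>
     (\<forall>j\<in>J. let \<nu> = coupling P (i, j) *\<^sub>v x in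
        \<forall>s<coupling_dim P {i, j}.
          (\<nu> $ s = 1 \<longrightarrow> \<Delta> (i, j) $ s \<ge> 0) \<and> (\<nu> $ s = 0 \<longrightarrow> \<Delta> (i, j) $ s \<le> 0)) \<and>
     opt_labeling P (add_dual \<phi> \<Delta>) i x}"

text \<open>
  The algorithm is nondeterministic, so it is described by relations. \<open>update_step P i J \<phi> \<Delta>\<close>
  says that \<open>\<Delta>\<close> is a possible output of the update step for factor \<open>i\<close> and set \<open>J\<close>.
\<close>

definition update_step :: "irps_lp \<Rightarrow> nat \<Rightarrow> nat set \<Rightarrow> dual \<Rightarrow> dual \<Rightarrow> bool" where
  "update_step P i J \<phi> \<Delta> \<longleftrightarrow> J \<subseteq> nbrs P i \<and>
     (\<exists>x \<delta>. opt_labeling P \<phi> i x \<and>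
        \<delta> \<in> carrier_vec (label_dim P i) \<and>
        (\<forall>s<label_dim P i. (x $ s = 1 \<longrightarrow> \<delta> $ s > 0) \<and> (x $ s = 0 \<longrightarrow> \<delta> $ s < 0)) \<and>
        is_arg_max (\<lambda>\<Delta>'. \<delta> \<bullet> reparam P (add_dual \<phi> \<Delta>') i) (\<lambda>\<Delta>'. \<Delta>' \<in> AD P \<phi> i x J) \<Delta>)"

text \<open>
  In the relations below, \<open>\<phi>s\<close> lists the values taken by the dual variables after each
  successive update, starting from \<open>\<phi>\<close> (which is not itself in the list). The list \<open>js\<close>
  enumerates \<open>J\<^bsub>receive\<^esub>\<close>, and \<open>order\<close> enumerates the factors.
\<close>

inductive receive_run :: "irps_lp \<Rightarrow> nat \<Rightarrow> nat list \<Rightarrow> dual \<Rightarrow> dual list \<Rightarrow> bool"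
  for P i where
  receive_Nil: "receive_run P i [] \<phi> []"
| receive_Cons: "update_step P j {i} \<phi> \<Delta> \<Longrightarrow> receive_run P i js (add_dual \<phi> \<Delta>) \<phi>s \<Longrightarrow>
    receive_run P i (j # js) \<phi> (add_dual \<phi> \<Delta> # \<phi>s)"

definition send :: "irps_lp \<Rightarrow> nat \<Rightarrow> dual \<Rightarrow> dual \<Rightarrow> bool" where
  "send P i \<phi> \<phi>' \<longleftrightarrow>
     (\<exists>(l::nat) J \<Delta> \<omega>.
        disjoint_family_on J {..<l} \<and> (\<Union>t<l. J t) \<subseteq> nbrs P i \<and>
        (\<forall>t<l. update_step P i (J t) \<phi> (\<Delta> t)) \<and>
        (\<forall>t<l. \<omega> t \<ge> 0) \<and> (\<Sum>t<l. \<omega> t) \<le> 1 \<and>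
        \<phi>' = add_dual \<phi> (\<lambda>(a, b).
          finsum_vec TYPE(real) (coupling_dim P {a, b}) (\<lambda>t. \<omega> t \<cdot>\<^sub>v \<Delta> t (a, b)) {..<l}))"

definition factor_run :: "irps_lp \<Rightarrow> nat \<Rightarrow> dual \<Rightarrow> dual list \<Rightarrow> bool" where
  "factor_run P i \<phi> \<phi>s \<longleftrightarrow>
     (\<exists>js \<psi>s \<phi>'. distinct js \<and> set js \<subseteq> nbrs P i \<and> receive_run P i js \<phi> \<psi>s \<and>
        send P i (last (\<phi> # \<psi>s)) \<phi>' \<and> \<phi>s = \<psi>s @ [\<phi>'])"

inductive factors_run :: "irps_lp \<Rightarrow> nat list \<Rightarrow> dual \<Rightarrow> dual list \<Rightarrow> bool"
  for P where
  factors_Nil: "factors_run P [] \<phi> []"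
| factors_Cons: "factor_run P i \<phi> \<psi>s \<Longrightarrow> factors_run P order (last (\<phi> # \<psi>s)) \<phi>s \<Longrightarrow>
    factors_run P (i # order) \<phi> (\<psi>s @ \<phi>s)"

definition iteration :: "irps_lp \<Rightarrow> dual \<Rightarrow> dual list \<Rightarrow> bool" where
  "iteration P \<phi> \<phi>s \<longleftrightarrow>
     (\<exists>order. distinct order \<and> set order = factors P \<and> factors_run P order \<phi> \<phi>s)"

end

theory Submission
  imports Defs
begin

text \<open>
  A dual increment \<open>\<Delta> \<in> AD\<close> for the factor \<open>i\<close> and the labeling \<open>x\<close> raises the minimum of
  factor \<open>i\<close> by \<open>\<Sum>j\<in>J. \<Delta>\<^bsub>(i,j)\<^esub> \<bullet> A\<^bsub>(i,j)\<^esub> x\<close>, since \<open>x\<close> stays optimal. The sign conditions say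
  that \<open>A\<^bsub>(i,j)\<^esub> x\<close> maximizes \<open>\<nu> \<mapsto> \<Delta>\<^bsub>(i,j)\<^esub> \<bullet> \<nu>\<close> over binary vectors, so the minimum of
  factor \<open>j\<close>, whose cost changes by \<open>- \<Delta>\<^bsub>(i,j)\<^esub>\<close>, drops by at most \<open>\<Delta>\<^bsub>(i,j)\<^esub> \<bullet> A\<^bsub>(i,j)\<^esub> x\<close>.
  Hence a single increment does not decrease the dual bound. As a sum of minima of affine
  functions the dual bound is concave, so neither does the weighted combination of increments
  in the send step.
\<close>

section \<open>Binary vectors, vector sums, minima and sorted lists\<close>

text \<open>Makes the label sets of the factors finite, so that \<open>Min\<close> over a nonempty
  one is a true minimum.\<close>

lemma finite_binary_vecs: "finite (binary_vecs n)"
proof (rule finite_subset)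
  show "binary_vecs n \<subseteq> vec n ` ({..<n} \<rightarrow>\<^sub>E {0, 1})"
  proof
    fix x assume x: "x \<in> binary_vecs n"
    have "x = vec n (restrict (($) x) {..<n})"
      using x by (auto simp: binary_vecs_def)
    moreover have "restrict (($) x) {..<n} \<in> {..<n} \<rightarrow>\<^sub>E {0, 1}"
      using x by (auto simp: binary_vecs_def)
    ultimately show "x \<in> vec n ` ({..<n} \<rightarrow>\<^sub>E {0, 1})" by blast
  qed
qed (auto intro: finite_PiE)

text \<open>Turns the \<open>finsum_vec\<close> in \<open>reparam\<close> and in \<open>send\<close>
  into ordinary sums of scalar products, on which all estimates are carried out.\<close>

lemma finsum_vec_scalar_prod:
  fixes f :: "'b \<Rightarrow> 'a :: comm_semiring_0 vec"
  assumes "finite S" and "f \<in> S \<rightarrow> carrier_vec n" and "w \<in> carrier_vec n"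
  shows "finsum_vec TYPE('a) n f S \<bullet> w = (\<Sum>j\<in>S. f j \<bullet> w)"
  using assms
proof (induction S rule: finite_induct)
  case empty
  then show ?case by (simp add: finsum_vec_empty)
next
  case (insert a S)
  then have "finsum_vec TYPE('a) n f S \<in> carrier_vec n"
    by (intro finsum_vec_closed) auto
  with insert show ?case
    by (simp add: finsum_vec_insert add_scalar_prod_distrib[of _ n])
qed

text \<open>Holds in each coordinate: where \<open>v\<close> is 1, \<open>d\<close> is nonnegative
  and \<open>u\<close> is at most 1; where \<open>v\<close> is 0, \<open>d\<close> is nonpositive
  and \<open>u\<close> is at least 0.\<close>

lemma binary_scalar_prod_le:
  assumes "d \<in> carrier_vec n" and "u \<in> binary_vecs n" and "v \<in> binary_vecs n"
    and "\<forall>s<n. (v $ s = 1 \<longrightarrow> d $ s \<ge> 0) \<and> (v $ s = 0 \<longrightarrow> d $ s \<le> 0)"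
  shows "d \<bullet> u \<le> d \<bullet> v"
proof -
  have "d $ s * u $ s \<le> d $ s * v $ s" if "s < n" for s
  proof -
    have "u $ s = 0 \<or> u $ s = 1" "v $ s = 0 \<or> v $ s = 1"
      using assms(2,3) that by (auto simp: binary_vecs_def)
    then show ?thesis using assms(4) that by auto
  qed
  then show ?thesis
    using assms(1-3) by (auto simp: scalar_prod_def binary_vecs_def intro!: sum_mono)
qed

text \<open>The zero vector is binary, so it can serve as the competitor \<open>u\<close> of
  \<open>binary_scalar_prod_le\<close>.\<close>

lemma binary_scalar_prod_nonneg:
  assumes "d \<in> carrier_vec n" and "v \<in> binary_vecs n"
    and "\<forall>s<n. (v $ s = 1 \<longrightarrow> d $ s \<ge> 0) \<and> (v $ s = 0 \<longrightarrow> d $ s \<le> 0)"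
  shows "0 \<le> d \<bullet> v"
proof -
  have "0\<^sub>v n \<in> binary_vecs n" by (simp add: binary_vecs_def)
  from binary_scalar_prod_le[OF assms(1) this assms(2,3)] show ?thesis
    using assms(1) by simp
qed

text \<open>The last premise controls the unspecified value of \<^const>\<open>Min\<close> at the empty set.\<close>

lemma Min_image_add_le:
  fixes f g :: "'a \<Rightarrow> real"
  assumes "finite L" and "\<And>y. y \<in> L \<Longrightarrow> Min (f ` L) + c \<le> g y" and "L = {} \<Longrightarrow> c \<le> 0"
  shows "Min (f ` L) + c \<le> Min (g ` L)"
  using assms by (cases "L = {}") auto

text \<open>Glues consecutive runs: a run does not list its starting point, and the next run starts
  at the last value reached, which is \<open>a\<close> itself if \<open>xs\<close> is empty.\<close>

lemma sorted_map_append_last: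
  assumes "sorted (map f (a # xs))" and "sorted (map f (last (a # xs) # ys))"
  shows "sorted (map f (a # xs @ ys))"
  using assms
proof (induction xs arbitrary: a)
  case Nil
  then show ?case by simp
next
  case (Cons b xs)
  then have "sorted (map f (b # xs @ ys))" by auto
  with Cons.prems(1) show ?case by (auto intro: order_trans)
qed

section \<open>Reparametrized costs as affine functions of the dual variables\<close>

text \<open>The \<phi>-dependent part of the reparametrized cost of \<open>x\<close>, with the
  transposed matrices moved over to \<open>x\<close>. In this form it is visibly linear in
  \<phi>.\<close>

definition coupling_cost :: "irps_lp \<Rightarrow> dual \<Rightarrow> nat \<Rightarrow> real vec \<Rightarrow> real" where
  "coupling_cost P \<phi> i x = (\<Sum>j\<in>nbrs P i. \<phi> (i, j) \<bullet> (coupling P (i, j) *\<^sub>v x))"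

locale irps =
  fixes P :: irps_lp
  assumes valid: "valid_irps_lp P"
begin

lemma edge_factors:
  assumes "{i, j} \<in> edges P"
  shows "i \<in> factors P" "j \<in> factors P" "i \<noteq> j"
proof -
  have "{i, j} \<subseteq> factors P" and c: "card {i, j} = 2"
    using assms valid unfolding valid_irps_lp_def by blast+
  then show "i \<in> factors P" "j \<in> factors P" by auto
  show "i \<noteq> j" using c by auto
qed

lemma finite_nbrs: "finite (nbrs P i)"
proof (rule finite_subset)
  show "nbrs P i \<subseteq> factors P" by (auto simp: nbrs_def dest: edge_factors)
qed (simp add: factors_def)

lemma coupling_binary:
  "{i, j} \<in> edges P \<Longrightarrow> x \<in> labelings P i \<Longrightarrow>
    coupling P (i, j) *\<^sub>v x \<in> binary_vecs (coupling_dim P {i, j})"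
  using valid by (auto simp: valid_irps_lp_def)

lemma coupling_mult_carrier:
  "{i, j} \<in> edges P \<Longrightarrow> x \<in> labelings P i \<Longrightarrow>
    coupling P (i, j) *\<^sub>v x \<in> carrier_vec (coupling_dim P {i, j})"
  using coupling_binary by (auto simp: binary_vecs_def)

lemma dual_carrier:
  "\<phi> \<in> dual_vars P \<Longrightarrow> {i, j} \<in> edges P \<Longrightarrow> \<phi> (i, j) \<in> carrier_vec (coupling_dim P {i, j})"
  unfolding dual_vars_def by blast

lemma dual_skew: "\<phi> \<in> dual_vars P \<Longrightarrow> {i, j} \<in> edges P \<Longrightarrow> \<phi> (i, j) = - \<phi> (j, i)"
  unfolding dual_vars_def by blast

lemma finite_labelings: "i \<in> factors P \<Longrightarrow> finite (labelings P i)"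
  using valid finite_binary_vecs finite_subset unfolding valid_irps_lp_def by metis

text \<open>Each summand is rewritten by the adjoint identity that a transposed matrix may be moved
  to the other side of a scalar product.\<close>

lemma reparam_scalar_prod:
  assumes "\<phi> \<in> dual_vars P" and i: "i \<in> factors P" and "x \<in> labelings P i"
  shows "reparam P \<phi> i \<bullet> x = costs P i \<bullet> x + coupling_cost P \<phi> i x"
proof -
  let ?f = "\<lambda>j. transpose_mat (coupling P (i, j)) *\<^sub>v \<phi> (i, j)"
  let ?n = "label_dim P i"
  have x: "x \<in> carrier_vec ?n" and c: "costs P i \<in> carrier_vec ?n"
    using valid assms by (auto simp: valid_irps_lp_def binary_vecs_def)
  have A: "coupling P (i, j) \<in> carrier_mat (coupling_dim P {i, j}) ?n" if "j \<in> nbrs P i" for j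
    using valid that by (auto simp: valid_irps_lp_def nbrs_def)
  have p: "\<phi> (i, j) \<in> carrier_vec (coupling_dim P {i, j})" if "j \<in> nbrs P i" for j
    using assms(1) that by (auto simp: nbrs_def dual_carrier)
  have f: "?f \<in> nbrs P i \<rightarrow> carrier_vec ?n"
    using A p by fastforce
  have "reparam P \<phi> i \<bullet> x = costs P i \<bullet> x + finsum_vec TYPE(real) ?n ?f (nbrs P i) \<bullet> x"
    unfolding reparam_def
    by (rule add_scalar_prod_distrib[OF c _ x]) (use f in \<open>auto intro!: finsum_vec_closed\<close>)
  also have "finsum_vec TYPE(real) ?n ?f (nbrs P i) \<bullet> x = (\<Sum>j\<in>nbrs P i. ?f j \<bullet> x)"
    by (rule finsum_vec_scalar_prod[OF finite_nbrs f x])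
  also have "\<dots> = coupling_cost P \<phi> i x"
    unfolding coupling_cost_def
    by (intro sum.cong refl transpose_vec_mult_scalar[OF A x p])
  finally show ?thesis .
qed

lemma add_dual_in_dual_vars:
  assumes "\<phi> \<in> dual_vars P" and "\<Delta> \<in> dual_vars P"
  shows "add_dual \<phi> \<Delta> \<in> dual_vars P"
  unfolding dual_vars_def
proof (intro CollectI allI impI)
  fix i j assume e: "{i, j} \<in> edges P"
  then have e': "{j, i} \<in> edges P" by (simp add: insert_commute)
  let ?K = "coupling_dim P {i, j}"
  have "\<phi> (i, j) = - \<phi> (j, i)" "\<Delta> (i, j) = - \<Delta> (j, i)"
    by (rule dual_skew[OF assms(1) e], rule dual_skew[OF assms(2) e])
  moreover have "\<phi> (j, i) \<in> carrier_vec ?K" "\<Delta> (j, i) \<in> carrier_vec ?K"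
    using dual_carrier[OF assms(1) e'] dual_carrier[OF assms(2) e'] by (auto simp: insert_commute)
  ultimately show "add_dual \<phi> \<Delta> (i, j) \<in> carrier_vec ?K \<and>
      add_dual \<phi> \<Delta> (i, j) = - add_dual \<phi> \<Delta> (j, i)"
    by (auto simp: add_dual_def)
qed

lemma coupling_cost_add_dual:
  assumes "\<phi> \<in> dual_vars P" and "\<Delta> \<in> dual_vars P" and "x \<in> labelings P i"
  shows "coupling_cost P (add_dual \<phi> \<Delta>) i x = coupling_cost P \<phi> i x + coupling_cost P \<Delta> i x"
  unfolding coupling_cost_def add_dual_def sum.distrib[symmetric]
proof (intro sum.cong refl)
  fix j assume "j \<in> nbrs P i"
  then have e: "{i, j} \<in> edges P" by (simp add: nbrs_def)
  show "(\<phi> (i, j) + \<Delta> (i, j)) \<bullet> (coupling P (i, j) *\<^sub>v x) =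
      \<phi> (i, j) \<bullet> (coupling P (i, j) *\<^sub>v x) + \<Delta> (i, j) \<bullet> (coupling P (i, j) *\<^sub>v x)"
    by (rule add_scalar_prod_distrib[OF dual_carrier[OF assms(1) e] dual_carrier[OF assms(2) e]
        coupling_mult_carrier[OF e assms(3)]])
qed

lemma reparam_add_dual:
  assumes "\<phi> \<in> dual_vars P" and "\<Delta> \<in> dual_vars P" and "i \<in> factors P" and "x \<in> labelings P i"
  shows "reparam P (add_dual \<phi> \<Delta>) i \<bullet> x = reparam P \<phi> i \<bullet> x + coupling_cost P \<Delta> i x"
  using assms by (simp add: reparam_scalar_prod add_dual_in_dual_vars coupling_cost_add_dual)

lemma Min_le_reparam:
  "i \<in> factors P \<Longrightarrow> x \<in> labelings P i \<Longrightarrow>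
    Min ((\<lambda>x. reparam P \<phi> i \<bullet> x) ` labelings P i) \<le> reparam P \<phi> i \<bullet> x"
  by (simp add: finite_labelings)

lemma opt_labeling_Min:
  assumes "opt_labeling P \<phi> i x" and "i \<in> factors P"
  shows "Min ((\<lambda>x. reparam P \<phi> i \<bullet> x) ` labelings P i) = reparam P \<phi> i \<bullet> x"
  using assms unfolding opt_labeling_def is_arg_min_linorder
  by (intro Min_eqI) (auto simp: finite_labelings)

section \<open>Ascent along a single admissible increment\<close>

text \<open>The change of each factor's minimum is bounded below by a number \<open>c k\<close>, and
  these numbers sum to zero over all factors.\<close>

lemma dual_bound_add_AD:
  assumes phi: "\<phi> \<in> dual_vars P" and J: "J \<subseteq> nbrs P i"
    and x: "opt_labeling P \<phi> i x" and AD: "\<Delta> \<in> AD P \<phi> i x J"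
  shows "dual_bound P \<phi> \<le> dual_bound P (add_dual \<phi> \<Delta>)"
proof -
  let ?t = "\<lambda>j. \<Delta> (i, j) \<bullet> (coupling P (i, j) *\<^sub>v x)"
  \<comment> \<open>Factor \<open>i\<close> gains exactly the sum of all \<open>?t j\<close>, a
    neighbour \<open>k\<close> in \<open>J\<close> loses at most \<open>?t k\<close>, and no other
    factor is affected.\<close>
  define c where "c k = (if k = i then sum ?t J else if k \<in> J then - ?t k else 0)" for k
  let ?m = "\<lambda>\<phi> k. Min ((\<lambda>y. reparam P \<phi> k \<bullet> y) ` labelings P k)"
  have D: "\<Delta> \<in> dual_vars P" and x': "opt_labeling P (add_dual \<phi> \<Delta>) i x"
    and zero: "\<And>a b. {a, b} \<in> edges P \<Longrightarrow> \<not> (a = i \<and> b \<in> J) \<Longrightarrow> \<not> (b = i \<and> a \<in> J) \<Longrightarrow>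
        \<Delta> (a, b) = 0\<^sub>v (coupling_dim P {a, b})"
    and sign: "\<And>j. j \<in> J \<Longrightarrow> \<forall>s<coupling_dim P {i, j}.
          ((coupling P (i, j) *\<^sub>v x) $ s = 1 \<longrightarrow> \<Delta> (i, j) $ s \<ge> 0) \<and>
          ((coupling P (i, j) *\<^sub>v x) $ s = 0 \<longrightarrow> \<Delta> (i, j) $ s \<le> 0)"
    using AD unfolding AD_def Let_def by blast+
  have xL: "x \<in> labelings P i" using x by (simp add: opt_labeling_def is_arg_min_def)
  have edge: "{i, j} \<in> edges P" "{j, i} \<in> edges P" if "j \<in> J" for j
    using J that by (auto simp: nbrs_def insert_commute)
  have iJ: "i \<notin> J" using edge edge_factors(3) by blast
  have finJ: "finite J" using J finite_nbrs finite_subset by blast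
  have zero_cost: "\<Delta> (k, j) \<bullet> (coupling P (k, j) *\<^sub>v y) = 0"
    if "y \<in> labelings P k" "{k, j} \<in> edges P" "\<not> (k = i \<and> j \<in> J)" "\<not> (j = i \<and> k \<in> J)" for k j y
    using that coupling_mult_carrier[of k j y] zero[of k j] by simp
  \<comment> \<open>Neighbours outside \<open>J\<close> contribute nothing, as \<Delta> vanishes on
    their edges to \<open>i\<close>.\<close>
  have cost_i: "coupling_cost P \<Delta> i x = c i"
    unfolding coupling_cost_def c_def
    using J iJ xL zero_cost by (auto simp: nbrs_def intro!: sum.mono_neutral_right finite_nbrs[unfolded nbrs_def])
  have cost_ge: "c k \<le> coupling_cost P \<Delta> k y" if k: "k \<noteq> i" and y: "y \<in> labelings P k" for k y
  proof (cases "k \<in> J")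
    case True
    let ?K = "coupling_dim P {i, k}"
    \<comment> \<open>Of all edges at \<open>k\<close>, only the one to \<open>i\<close> carries a
      nonzero increment, even if other neighbours of \<open>k\<close> lie in
      \<open>J\<close>.\<close>
    have "coupling_cost P \<Delta> k y = (\<Sum>j\<in>{i}. \<Delta> (k, j) \<bullet> (coupling P (k, j) *\<^sub>v y))"
      unfolding coupling_cost_def
      by (rule sum.mono_neutral_right)
        (use edge[OF True] k y zero_cost finite_nbrs in \<open>auto simp: nbrs_def\<close>)
    also have "\<dots> = - \<Delta> (i, k) \<bullet> (coupling P (k, i) *\<^sub>v y)"
      using dual_skew[OF D edge(2)[OF True]] by simp
    finally have eq: "coupling_cost P \<Delta> k y = - (\<Delta> (i, k) \<bullet> (coupling P (k, i) *\<^sub>v y))"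
      using uminus_scalar_prod[OF dual_carrier[OF D edge(1)[OF True]]]
        coupling_mult_carrier[OF edge(2)[OF True] y] by (simp add: insert_commute)
    \<comment> \<open>Both sides of the edge map into binary vectors of the same dimension, so the
      image of \<open>y\<close> competes with that of \<open>x\<close>, which is optimal by the sign
      conditions.\<close>
    have "\<Delta> (i, k) \<bullet> (coupling P (k, i) *\<^sub>v y) \<le> ?t k"
    proof (rule binary_scalar_prod_le)
      show "coupling P (k, i) *\<^sub>v y \<in> binary_vecs ?K"
        using coupling_binary[OF edge(2)[OF True] y] by (simp add: insert_commute)
    qed (use dual_carrier[OF D edge(1)] coupling_binary[OF edge(1) xL] sign True in blast)+
    with eq True k show ?thesis by (simp add: c_def)
  next
    case False
    then have "coupling_cost P \<Delta> k y = 0"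
      unfolding coupling_cost_def using k y by (intro sum.neutral) (auto simp: nbrs_def intro: zero_cost)
    with False k show ?thesis by (simp add: c_def)
  qed
  \<comment> \<open>Serves factors without labelings: there both minima are the same unspecified
    number, so their difference 0 must be bounded below by \<open>c k\<close>.\<close>
  have c_nonpos: "c k \<le> 0" if "k \<noteq> i" for k
    using that dual_carrier[OF D edge(1)] coupling_binary[OF edge(1) xL] sign
    by (auto simp: c_def intro!: binary_scalar_prod_nonneg)
  have "?m \<phi> k + c k \<le> ?m (add_dual \<phi> \<Delta>) k" if k: "k \<in> factors P" for k
  proof (cases "k = i")
    case True
    \<comment> \<open>Since \<open>x\<close> is optimal before and after the increment, the minimum
      moves by exactly the cost change at \<open>x\<close>.\<close>
    with k show ?thesis
      using reparam_add_dual[OF phi D _ xL] cost_i opt_labeling_Min[OF x] opt_labeling_Min[OF x']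
      by simp
  next
    case False
    show ?thesis
    proof (rule Min_image_add_le[OF finite_labelings[OF k]])
      fix y assume y: "y \<in> labelings P k"
      show "?m \<phi> k + c k \<le> reparam P (add_dual \<phi> \<Delta>) k \<bullet> y"
        using reparam_add_dual[OF phi D k y] cost_ge[OF False y] Min_le_reparam[OF k y, of \<phi>] by simp
    qed (rule c_nonpos[OF False])
  qed
  then have "(\<Sum>k\<in>factors P. ?m \<phi> k) + (\<Sum>k\<in>factors P. c k) \<le> (\<Sum>k\<in>factors P. ?m (add_dual \<phi> \<Delta>) k)"
    by (simp add: sum.distrib[symmetric] sum_mono)
  moreover have "(\<Sum>k\<in>factors P. c k) = 0"
  \<comment> \<open>That \<open>i\<close> is a factor is read off from an edge to some member of
    \<open>J\<close>; for empty \<open>J\<close>, \<open>c\<close> is zero everywhere.\<close>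
  proof (cases "J = {}")
    case True
    then show ?thesis by (intro sum.neutral) (simp add: c_def)
  next
    case False
    then have "insert i J \<subseteq> factors P" using edge edge_factors by blast
    then have "(\<Sum>k\<in>factors P. c k) = (\<Sum>k\<in>insert i J. c k)"
      by (intro sum.mono_neutral_right) (auto simp: c_def factors_def)
    also have "\<dots> = sum ?t J + (\<Sum>k\<in>J. - ?t k)"
      using iJ finJ by (auto simp: c_def intro!: sum.cong)
    finally show ?thesis by (simp add: sum_negf)
  qed
  ultimately show ?thesis by (simp add: dual_bound_def)
qed

text \<open>A maximizer over \<open>AD\<close> is a member of \<open>AD\<close>, so the ascent along
  admissible increments applies.\<close>

lemma update_step_dual_bound:
  assumes "\<phi> \<in> dual_vars P" and "update_step P i J \<phi> \<Delta>"
  shows "\<Delta> \<in> dual_vars P" and "dual_bound P \<phi> \<le> dual_bound P (add_dual \<phi> \<Delta>)"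
proof -
  obtain x where "J \<subseteq> nbrs P i" "opt_labeling P \<phi> i x" "\<Delta> \<in> AD P \<phi> i x J"
    using assms(2) unfolding update_step_def is_arg_max_def by blast
  then show "\<Delta> \<in> dual_vars P" "dual_bound P \<phi> \<le> dual_bound P (add_dual \<phi> \<Delta>)"
    using dual_bound_add_AD[OF assms(1)] by (auto simp: AD_def)
qed

section \<open>Concavity and the weighted send step\<close>

text \<open>Names the increment that \<open>send\<close> spells out, so that it can be treated as
  one dual vector.\<close>

definition combine :: "nat \<Rightarrow> (nat \<Rightarrow> real) \<Rightarrow> (nat \<Rightarrow> dual) \<Rightarrow> dual" where
  "combine l \<omega> \<Delta> = (\<lambda>(a, b).
     finsum_vec TYPE(real) (coupling_dim P {a, b}) (\<lambda>t. \<omega> t \<cdot>\<^sub>v \<Delta> t (a, b)) {..<l})"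

lemma combine_in_dual_vars:
  assumes "\<And>t. t < l \<Longrightarrow> \<Delta> t \<in> dual_vars P"
  shows "combine l \<omega> \<Delta> \<in> dual_vars P"
  unfolding dual_vars_def
proof (intro CollectI allI impI)
  fix i j assume e: "{i, j} \<in> edges P"
  then have e': "{j, i} \<in> edges P" by (simp add: insert_commute)
  let ?K = "coupling_dim P {i, j}"
  have d: "\<Delta> t (i, j) \<in> carrier_vec ?K" "\<Delta> t (j, i) \<in> carrier_vec ?K" "\<Delta> t (i, j) = - \<Delta> t (j, i)"
    if "t < l" for t
    using dual_carrier[OF assms[OF that] e] dual_carrier[OF assms[OF that] e']
      dual_skew[OF assms[OF that] e] by (simp_all only: insert_commute)
  have c: "combine l \<omega> \<Delta> (i, j) \<in> carrier_vec ?K" "combine l \<omega> \<Delta> (j, i) \<in> carrier_vec ?K"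
    using d by (auto simp: combine_def insert_commute intro!: finsum_vec_closed)
  \<comment> \<open>Checked entrywise, where the vector sum becomes a real sum and the sign can be
    pulled out.\<close>
  moreover have "combine l \<omega> \<Delta> (i, j) = - combine l \<omega> \<Delta> (j, i)"
  proof (rule eq_vecI)
    fix s assume "s < dim_vec (- combine l \<omega> \<Delta> (j, i))"
    then have s: "s < ?K" using c by auto
    have "combine l \<omega> \<Delta> (i, j) $ s = (\<Sum>t<l. (\<omega> t \<cdot>\<^sub>v \<Delta> t (i, j)) $ s)"
      unfolding combine_def prod.case by (rule index_finsum_vec) (use d(1) s in auto)
    also have "\<dots> = (\<Sum>t<l. - (\<omega> t \<cdot>\<^sub>v \<Delta> t (j, i)) $ s)"
    proof (intro sum.cong refl)
      fix t assume "t \<in> {..<l}"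
      then have "\<Delta> t (i, j) = - \<Delta> t (j, i)" "dim_vec (\<Delta> t (j, i)) = ?K" using d by auto
      then show "(\<omega> t \<cdot>\<^sub>v \<Delta> t (i, j)) $ s = - (\<omega> t \<cdot>\<^sub>v \<Delta> t (j, i)) $ s" using s by simp
    qed
    also have "\<dots> = - (\<Sum>t<l. (\<omega> t \<cdot>\<^sub>v \<Delta> t (j, i)) $ s)" by (simp add: sum_negf)
    also have "(\<Sum>t<l. (\<omega> t \<cdot>\<^sub>v \<Delta> t (j, i)) $ s) = combine l \<omega> \<Delta> (j, i) $ s"
      unfolding combine_def prod.case insert_commute[of j]
      by (rule index_finsum_vec[symmetric]) (use d(2) s in auto)
    finally show "combine l \<omega> \<Delta> (i, j) $ s = (- combine l \<omega> \<Delta> (j, i)) $ s"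
      using c s by auto
  qed (use c in auto)
  ultimately show "combine l \<omega> \<Delta> (i, j) \<in> carrier_vec ?K \<and>
      combine l \<omega> \<Delta> (i, j) = - combine l \<omega> \<Delta> (j, i)" by blast
qed

lemma coupling_cost_combine:
  assumes D: "\<And>t. t < l \<Longrightarrow> \<Delta> t \<in> dual_vars P" and x: "x \<in> labelings P i"
  shows "coupling_cost P (combine l \<omega> \<Delta>) i x = (\<Sum>t<l. \<omega> t * coupling_cost P (\<Delta> t) i x)"
proof -
  have "combine l \<omega> \<Delta> (i, j) \<bullet> (coupling P (i, j) *\<^sub>v x) =
      (\<Sum>t<l. \<omega> t * (\<Delta> t (i, j) \<bullet> (coupling P (i, j) *\<^sub>v x)))" if "j \<in> nbrs P i" for j
  proof -
    have e: "{i, j} \<in> edges P" using that by (simp add: nbrs_def)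
    let ?K = "coupling_dim P {i, j}"
    have "combine l \<omega> \<Delta> (i, j) \<bullet> (coupling P (i, j) *\<^sub>v x) =
        (\<Sum>t<l. (\<omega> t \<cdot>\<^sub>v \<Delta> t (i, j)) \<bullet> (coupling P (i, j) *\<^sub>v x))"
      unfolding combine_def prod.case
      by (rule finsum_vec_scalar_prod)
        (use dual_carrier[OF D e] coupling_mult_carrier[OF e x] in auto)
    also have "\<dots> = (\<Sum>t<l. \<omega> t * (\<Delta> t (i, j) \<bullet> (coupling P (i, j) *\<^sub>v x)))"
      by (intro sum.cong refl smult_scalar_prod_distrib[of _ ?K])
        (use dual_carrier[OF D e] coupling_mult_carrier[OF e x] in auto)
    finally show ?thesis .
  qed
  then show ?thesis
    unfolding coupling_cost_def sum_distrib_left by (subst sum.swap) (auto intro!: sum.cong)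
qed

text \<open>Jensen's inequality for the concave dual bound: the new point is the convex combination
  of \<phi>, with the leftover weight, and of the points \<open>add_dual \<phi> (\<Delta> t)\<close>
  with weights \<open>\<omega> t\<close>.\<close>

lemma dual_bound_combine:
  assumes phi: "\<phi> \<in> dual_vars P" and D: "\<And>t. t < l \<Longrightarrow> \<Delta> t \<in> dual_vars P"
    and w: "\<And>t. t < l \<Longrightarrow> \<omega> t \<ge> 0" "(\<Sum>t<l. \<omega> t) \<le> 1"
  shows "(1 - (\<Sum>t<l. \<omega> t)) * dual_bound P \<phi> +
      (\<Sum>t<l. \<omega> t * dual_bound P (add_dual \<phi> (\<Delta> t)))
    \<le> dual_bound P (add_dual \<phi> (combine l \<omega> \<Delta>))"
proof -
  let ?m = "\<lambda>\<phi> k. Min ((\<lambda>y. reparam P \<phi> k \<bullet> y) ` labelings P k)"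
  let ?w = "\<Sum>t<l. \<omega> t"
  let ?\<psi> = "add_dual \<phi> (combine l \<omega> \<Delta>)"
  have "(1 - ?w) * ?m \<phi> k + (\<Sum>t<l. \<omega> t * ?m (add_dual \<phi> (\<Delta> t)) k) \<le> ?m ?\<psi> k"
    if k: "k \<in> factors P" for k
  proof (cases "labelings P k = {}")
    case True
    \<comment> \<open>All minima over the empty set are one unspecified number, and the weights,
      including the leftover one, add up to 1.\<close>
    then show ?thesis by (simp add: sum_distrib_left[symmetric] algebra_simps)
  next
    case False
    have "(1 - ?w) * ?m \<phi> k + (\<Sum>t<l. \<omega> t * ?m (add_dual \<phi> (\<Delta> t)) k) \<le> reparam P ?\<psi> k \<bullet> y"
      if y: "y \<in> labelings P k" for y
    proof -
      \<comment> \<open>Every minimum is bounded by the value at the same labeling \<open>y\<close>,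
        where the reparametrized cost is affine in the dual variables and the weighted values add up
        exactly.\<close>
      have "(1 - ?w) * ?m \<phi> k \<le> (1 - ?w) * (reparam P \<phi> k \<bullet> y)"
        using w(2) Min_le_reparam[OF k y] by (intro mult_left_mono) auto
      moreover have "(\<Sum>t<l. \<omega> t * ?m (add_dual \<phi> (\<Delta> t)) k)
          \<le> (\<Sum>t<l. \<omega> t * (reparam P (add_dual \<phi> (\<Delta> t)) k \<bullet> y))"
        using w(1) Min_le_reparam[OF k y] by (intro sum_mono mult_left_mono) auto
      moreover have "(\<Sum>t<l. \<omega> t * (reparam P (add_dual \<phi> (\<Delta> t)) k \<bullet> y)) =
          ?w * (reparam P \<phi> k \<bullet> y) + coupling_cost P (combine l \<omega> \<Delta>) k y"
        using D by (simp add: reparam_add_dual[OF phi _ k y] coupling_cost_combine[OF D y]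
            distrib_left sum.distrib sum_distrib_right)
      moreover have "reparam P ?\<psi> k \<bullet> y = reparam P \<phi> k \<bullet> y + coupling_cost P (combine l \<omega> \<Delta>) k y"
        using combine_in_dual_vars[OF D] by (intro reparam_add_dual phi k y)
      ultimately show ?thesis by (simp add: algebra_simps)
    qed
    then show ?thesis using finite_labelings[OF k] False by simp
  qed
  then have "(\<Sum>k\<in>factors P. (1 - ?w) * ?m \<phi> k + (\<Sum>t<l. \<omega> t * ?m (add_dual \<phi> (\<Delta> t)) k))
      \<le> (\<Sum>k\<in>factors P. ?m ?\<psi> k)"
    by (rule sum_mono)
  then show ?thesis
    unfolding dual_bound_def sum_distrib_left sum.distrib by (subst sum.swap[where A = "{..<l}"])
qed

text \<open>All increments are computed at the same \<phi>, so each point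
  \<open>add_dual \<phi> (\<Delta> t)\<close> has at least the bound of \<phi>, and hence so has
  their convex combination with \<phi>.\<close>

lemma send_dual_bound:
  assumes phi: "\<phi> \<in> dual_vars P" and "send P i \<phi> \<phi>'"
  shows "\<phi>' \<in> dual_vars P" and "dual_bound P \<phi> \<le> dual_bound P \<phi>'"
proof -
  obtain l :: nat and J \<Delta> \<omega> where
    step: "\<And>t. t < l \<Longrightarrow> update_step P i (J t) \<phi> (\<Delta> t)"
    and w: "\<And>t. t < l \<Longrightarrow> \<omega> t \<ge> 0" "(\<Sum>t<l. \<omega> t) \<le> 1"
    and eq: "\<phi>' = add_dual \<phi> (combine l \<omega> \<Delta>)"
    using assms(2) unfolding send_def combine_def by blast
  note D = update_step_dual_bound[OF phi step]
  show "\<phi>' \<in> dual_vars P"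
    unfolding eq by (intro add_dual_in_dual_vars phi combine_in_dual_vars D(1))
  have "(\<Sum>t<l. \<omega> t * dual_bound P \<phi>) \<le> (\<Sum>t<l. \<omega> t * dual_bound P (add_dual \<phi> (\<Delta> t)))"
    by (intro sum_mono mult_left_mono D(2) w(1)) auto
  moreover have "(1 - (\<Sum>t<l. \<omega> t)) * dual_bound P \<phi> +
      (\<Sum>t<l. \<omega> t * dual_bound P (add_dual \<phi> (\<Delta> t)))
    \<le> dual_bound P (add_dual \<phi> (combine l \<omega> \<Delta>))"
    by (intro dual_bound_combine phi D(1) w)
  ultimately show "dual_bound P \<phi> \<le> dual_bound P \<phi>'"
    by (simp add: eq sum_distrib_right[symmetric] algebra_simps)
qed

section \<open>Monotonicity along complete runs\<close>

text \<open>Membership in \<open>dual_vars P\<close> is carried along because the ascent of every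
  further update presupposes it.\<close>

definition ascending :: "dual list \<Rightarrow> bool" where
  "ascending \<phi>s \<longleftrightarrow> set \<phi>s \<subseteq> dual_vars P \<and> sorted (map (dual_bound P) \<phi>s)"

lemma ascending_append_last:
  "ascending (\<phi> # \<psi>s) \<Longrightarrow> ascending (last (\<phi> # \<psi>s) # \<phi>s) \<Longrightarrow> ascending (\<phi> # \<psi>s @ \<phi>s)"
  unfolding ascending_def using sorted_map_append_last[of "dual_bound P" \<phi> \<psi>s \<phi>s] by auto

lemma ascending_Cons_Cons:
  "\<phi> \<in> dual_vars P \<Longrightarrow> dual_bound P \<phi> \<le> dual_bound P \<psi> \<Longrightarrow> ascending (\<psi> # \<phi>s) \<Longrightarrow>
    ascending (\<phi> # \<psi> # \<phi>s)"
  unfolding ascending_def by auto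

lemma ascending_last: "ascending (\<phi> # \<phi>s) \<Longrightarrow> last (\<phi> # \<phi>s) \<in> dual_vars P"
  unfolding ascending_def using last_in_set[of "\<phi> # \<phi>s"] by blast

lemma ascending_singleton: "\<phi> \<in> dual_vars P \<Longrightarrow> ascending [\<phi>]"
  by (simp add: ascending_def)

text \<open>A receive update is an update step of the neighbour \<open>j\<close> with the set
  \<open>{i}\<close>, hence again an ascent along one admissible increment.\<close>

lemma receive_run_ascending:
  "receive_run P i js \<phi> \<phi>s \<Longrightarrow> \<phi> \<in> dual_vars P \<Longrightarrow> ascending (\<phi> # \<phi>s)"
proof (induction rule: receive_run.induct)
  case (receive_Nil \<phi>)
  then show ?case by (rule ascending_singleton)
next
  case (receive_Cons j \<phi> \<Delta> js \<phi>s)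
  note D = update_step_dual_bound[OF receive_Cons.prems receive_Cons.hyps(1)]
  show ?case
    by (intro ascending_Cons_Cons D(2) receive_Cons.IH receive_Cons.prems add_dual_in_dual_vars D(1))
qed

lemma factor_run_ascending:
  assumes "factor_run P i \<phi> \<phi>s" and "\<phi> \<in> dual_vars P"
  shows "ascending (\<phi> # \<phi>s)"
proof -
  obtain js \<psi>s \<phi>' where r: "receive_run P i js \<phi> \<psi>s"
    and s: "send P i (last (\<phi> # \<psi>s)) \<phi>'" and eq: "\<phi>s = \<psi>s @ [\<phi>']"
    using assms(1) unfolding factor_run_def by blast
  note asc = receive_run_ascending[OF r assms(2)]
  note D = send_dual_bound[OF ascending_last[OF asc] s]
  show ?thesis
    unfolding eq
    by (intro ascending_append_last asc ascending_Cons_Cons ascending_last D ascending_singleton)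
qed

lemma factors_run_ascending:
  "factors_run P order \<phi> \<phi>s \<Longrightarrow> \<phi> \<in> dual_vars P \<Longrightarrow> ascending (\<phi> # \<phi>s)"
proof (induction rule: factors_run.induct)
  case (factors_Nil \<phi>)
  then show ?case by (rule ascending_singleton)
next
  case (factors_Cons i \<phi> \<psi>s order \<phi>s)
  note asc = factor_run_ascending[OF factors_Cons.hyps(1) factors_Cons.prems]
  show ?case
    by (intro ascending_append_last asc factors_Cons.IH ascending_last)
qed

end

theorem theorem1:
  fixes P :: irps_lp and \<phi> :: dual and \<phi>s :: "dual list"
  assumes "valid_irps_lp P"
    and "\<phi> \<in> dual_vars P"
    and "iteration P \<phi> \<phi>s"
  shows "sorted (map (dual_bound P) (\<phi> # \<phi>s)) \<and>
         dual_bound P \<phi> \<le> dual_bound P (last (\<phi> # \<phi>s))"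
proof -
  interpret irps P by unfold_locales (rule assms(1))
  have "sorted (map (dual_bound P) (\<phi> # \<phi>s))"
    using assms(2,3) factors_run_ascending unfolding iteration_def ascending_def by blast
  then show ?thesis by auto
qed

end
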